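(* Let $\mathcal{X}$ be a measurable set, let $\nu$ be a probability measure on $\mathcal{X}$, and let $(\mathcal{F},\lVert\cdot\rVert_{\mathcal{F}})$ be a Banach space of measurable functions $f:\mathcal{X}\to\mathbb{R}$ such that $\int_{\mathcal{X}}f(\boldsymbol{x})\,\nu(\mathrm{d}\boldsymbol{x})$ is defined for all $f\in\mathcal{F}$ (function evaluation is not required to be a bounded linear functional on $\mathcal{F}$). Let $T:\mathcal{F}\to\mathbb{R}$ be a bounded linear functional; if $\{T(f):f\in\mathcal{F}\}\neq\{0\}$, assume that $\mathcal{F}$ contains the constant functions. Let the vector space $\mathcal{M}_{\mathrm{S}}$ of all sampling measures be endowed with a probability distribution, and let $\widehat{\nu}$ denote a random sampling measure with this distribution. Assume that (i) $\mathbb{E}_{\widehat{\nu}}\bigl|\int_{\mathcal{X}}f(\boldsymbol{x})\,\widehat{\nu}(\mathrm{d}\boldsymbol{x})\bigr|^2<\infty$ for all $f\in\mathcal{F}$; and (ii) $\{T(f):f\in\mathcal{F}\}=\{0\}$, or $\widehat{\nu}(\mathcal{X})=\nu(\mathcal{X})$ almost surely. With the variation $\mathrm{VAR}^{\mathrm{D}}$, the randomized discrepancy $\mathrm{DSC}^{\mathrm{R}}$ and the randomized confounding $\mathrm{CNF}^{\mathrm{R}}$ as defined in the context, and with $\mu=\int_{\mathcal{X}}f(\boldsymbol{x})\,\nu(\mathrm{d}\boldsymbol{x})$ and $\widehat{\mu}=\int_{\mathcal{X}}f(\boldsymbol{x})\,\widehat{\nu}(\mathrm{d}\boldsymbol{x})$,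 the following error identity holds for all $f\in\mathcal{F}$ and $\widehat{\nu}\in\mathcal{M}_{\mathrm{S}}$: $$\mu-\widehat{\mu}=\mathrm{CNF}^{\mathrm{R}}(f,\nu-\widehat{\nu})\;\mathrm{DSC}^{\mathrm{R}}(\nu-\widehat{\nu})\;\mathrm{VAR}^{\mathrm{D}}(f)\qquad\text{almost surely}.$$ Moreover, $\mathbb{E}_{\widehat{\nu}}\bigl|\mathrm{CNF}^{\mathrm{R}}(f,\nu-\widehat{\nu})\bigr|^2\le1$ for all $f\in\mathcal{F}$.
   Context: Sampling measures: $\mathcal{M}_{\mathrm{S}}=\bigl\{\sum_{i=1}^n w_i\delta_{\boldsymbol{x}_i}: w_1,\dots,w_n\in\mathbb{R},\ \boldsymbol{x}_1,\dots,\boldsymbol{x}_n\in\mathcal{X},\ n\in\mathbb{N}\bigr\}$, where $\delta_{\boldsymbol{t}}$ is the Dirac measure at $\boldsymbol{t}$; for $\widehat{\nu}=\sum_{i=1}^n w_i\delta_{\boldsymbol{x}_i}$, $\int_{\mathcal{X}} f(\boldsymbol{x})\,\widehat{\nu}(\mathrm{d}\boldsymbol{x})=\sum_{i=1}^n w_i f(\boldsymbol{x}_i)$. The number $n$ of data sites, the placement of the data sites $\boldsymbol{x}_i$ and the weights $w_i$ may all be random. $\mathbb{E}_{\widehat{\nu}}$ and "almost surely" refer to the distribution of $\widehat{\nu}$. The functional $T$ provides a typical value of $f$; the number $T(f)$ is also regarded as the constant function with that value. The variation is $\mathrm{VAR}^{\mathrm{D}}(f):=\lVert f-T(f)\rVert_{\mathcal{F}}$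 for $f\in\mathcal{F}$. The randomized discrepancy, which depends on the distribution of the sampling measure and not on its particular instance, is $$\mathrm{DSC}^{\mathrm{R}}(\nu-\widehat{\nu}):=\sup_{f\in\mathcal{F}:\,f\neq0}\frac{\sqrt{\mathbb{E}_{\widehat{\nu}}\bigl|\int_{\mathcal{X}}f(\boldsymbol{x})\,(\nu-\widehat{\nu})(\mathrm{d}\boldsymbol{x})\bigr|^2}}{\lVert f\rVert_{\mathcal{F}}}.$$ The randomized confounding, which depends on the particular instance of the sampling measure, is $$\mathrm{CNF}^{\mathrm{R}}(f,\nu-\widehat{\nu}):=\frac{\int_{\mathcal{X}}f(\boldsymbol{x})\,(\nu-\widehat{\nu})(\mathrm{d}\boldsymbol{x})}{\mathrm{VAR}^{\mathrm{D}}(f)\,\mathrm{DSC}^{\mathrm{R}}(\nu-\widehat{\nu})}$$ if $\mathrm{VAR}^{\mathrm{D}}(f)\,\mathrm{DSC}^{\mathrm{R}}(\nu-\widehat{\nu})\neq0$, and $0$ otherwise.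
   Formalization: The error identity is stated under the added assumption that the randomized discrepancy DSC^R is finite, since the hypotheses allow DSC^R to be infinite and the identity then fails or is undefined; the bound E|CNF^R|^2 ≤ 1 is stated without it, with x/∞ = 0. *)

theory Defs
  imports "HOL-Probability.Probability"
begin

text \<open>
  Signed measures of finite support are represented by their set functions. Since the measure of
  a non-measurable set is \<open>0\<close> by convention, equality of these set functions is equality on
  the sigma-algebra.
\<close>

definition dirac_sum :: "'a measure \<Rightarrow> nat \<Rightarrow> (nat \<Rightarrow> real) \<Rightarrow> (nat \<Rightarrow> 'a) \<Rightarrow> 'a set \<Rightarrow> real" where
  "dirac_sum X n w x = (\<lambda>A. \<Sum>i<n. w i * measure (return X (x i)) A)"

definition sampling_measures :: "'a measure \<Rightarrow> ('a set \<Rightarrow> real) set" where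
  "sampling_measures X = {dirac_sum X n w x |n w x. \<forall>i<n. x i \<in> space X}"

text \<open>
  The representation of a sampling measure by weights and sites is not unique, but for measurable
  \<open>f\<close> the value below does not depend on it (lemma \<open>sampling_integral_dirac_sum\<close>).
\<close>

definition sampling_integral :: "'a measure \<Rightarrow> ('a set \<Rightarrow> real) \<Rightarrow> ('a \<Rightarrow> real) \<Rightarrow> real" where
  "sampling_integral X nuh f =
     (THE r. \<exists>n w x. (\<forall>i<n. x i \<in> space X) \<and> nuh = dirac_sum X n w x \<and> r = (\<Sum>i<n. w i * f (x i)))"

lemma dirac_sum_preimages:
  fixes f :: "'a \<Rightarrow> real"
  assumes f: "f \<in> borel_measurable X" and x: "\<forall>i<n. x i \<in> space X"
    and V: "finite V" "f ` x ` {..<n} \<subseteq> V"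
  shows "(\<Sum>i<n. w i * f (x i)) = (\<Sum>v\<in>V. v * dirac_sum X n w x (f -` {v} \<inter> space X))"
proof -
  have m: "measure (return X (x i)) (f -` {v} \<inter> space X) = (if f (x i) = v then 1 else 0)"
    if "i < n" for i v
  proof -
    have "f -` {v} \<inter> space X \<in> sets X"
      using f by (rule measurable_sets) simp
    then show ?thesis
      using that x by (simp add: measure_return indicator_def)
  qed
  have "(\<Sum>v\<in>V. v * dirac_sum X n w x (f -` {v} \<inter> space X)) =
        (\<Sum>v\<in>V. \<Sum>i<n. v * (w i * (if f (x i) = v then 1 else 0)))"
    unfolding dirac_sum_def by (simp add: m sum_distrib_left)
  also have "\<dots> = (\<Sum>i<n. \<Sum>v\<in>V. v * (w i * (if f (x i) = v then 1 else 0)))"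
    by (rule sum.swap)
  also have "\<dots> = (\<Sum>i<n. w i * f (x i))"
  proof (rule sum.cong[OF refl])
    fix i assume "i \<in> {..<n}"
    then have "f (x i) \<in> V" using V by auto
    have "(\<Sum>v\<in>V. v * (w i * (if f (x i) = v then 1 else 0))) =
          (\<Sum>v\<in>V. if f (x i) = v then v * w i else 0)"
      by (rule sum.cong) auto
    also have "\<dots> = w i * f (x i)"
      using V \<open>f (x i) \<in> V\<close> by (simp add: sum.delta')
    finally show "(\<Sum>v\<in>V. v * (w i * (if f (x i) = v then 1 else 0))) = w i * f (x i)" .
  qed
  finally show ?thesis by simp
qed

lemma sampling_integral_dirac_sum:
  fixes f :: "'a \<Rightarrow> real"
  assumes f: "f \<in> borel_measurable X" and x: "\<forall>i<n. x i \<in> space X"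
  shows "sampling_integral X (dirac_sum X n w x) f = (\<Sum>i<n. w i * f (x i))"
  unfolding sampling_integral_def
proof (rule the_equality)
  show "\<exists>m v y. (\<forall>i<m. y i \<in> space X) \<and> dirac_sum X n w x = dirac_sum X m v y \<and>
      (\<Sum>i<n. w i * f (x i)) = (\<Sum>i<m. v i * f (y i))"
    using x by blast
next
  fix r
  assume "\<exists>m v y. (\<forall>i<m. y i \<in> space X) \<and> dirac_sum X n w x = dirac_sum X m v y \<and>
      r = (\<Sum>i<m. v i * f (y i))"
  then obtain m v y where y: "\<forall>i<m. y i \<in> space X"
    and eq: "dirac_sum X n w x = dirac_sum X m v y" and r: "r = (\<Sum>i<m. v i * f (y i))"
    by blast
  define V where "V = f ` x ` {..<n} \<union> f ` y ` {..<m}"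
  have "finite V" "f ` x ` {..<n} \<subseteq> V" "f ` y ` {..<m} \<subseteq> V"
    by (auto simp: V_def)
  then show "r = (\<Sum>i<n. w i * f (x i))"
    unfolding r using dirac_sum_preimages[OF f x, of V w] dirac_sum_preimages[OF f y, of V v]
    by (simp add: eq)
qed

text \<open>
  A Banach space of measurable functions on \<open>space X\<close>: an abstract Banach space \<open>'f\<close> whose elements
  are identified, by the injective linear map \<open>val\<close>, with functions. Each evaluation
  \<open>\<lambda>f. val f x\<close> is linear but need not be bounded.
\<close>

definition function_space :: "'a measure \<Rightarrow> ('f::banach \<Rightarrow> 'a \<Rightarrow> real) \<Rightarrow> bool" where
  "function_space X val \<longleftrightarrow>
     (\<forall>f. val f \<in> borel_measurable X) \<and>
     (\<forall>x\<in>space X. linear (\<lambda>f. val f x)) \<and>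
     (\<forall>f g. (\<forall>x\<in>space X. val f x = val g x) \<longrightarrow> f = g)"

definition const_fun :: "'a measure \<Rightarrow> ('f::banach \<Rightarrow> 'a \<Rightarrow> real) \<Rightarrow> real \<Rightarrow> 'f" where
  "const_fun X val c = (THE g. \<forall>x\<in>space X. val g x = c)"

definition VAR_D :: "'a measure \<Rightarrow> ('f::banach \<Rightarrow> 'a \<Rightarrow> real) \<Rightarrow> ('f \<Rightarrow> real) \<Rightarrow> 'f \<Rightarrow> real" where
  "VAR_D X val T f = norm (f - const_fun X val (T f))"

definition diff_integral :: "'a measure \<Rightarrow> ('a set \<Rightarrow> real) \<Rightarrow> ('a \<Rightarrow> real) \<Rightarrow> real" where
  "diff_integral nu nuh f = (\<integral>x. f x \<partial>nu) - sampling_integral nu nuh f"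

text \<open>
  \<open>P\<close> is the distribution of the sampling measure. The supremum is taken in \<open>[0, \<infinity>]\<close>: it is
  \<open>0\<close> for the trivial function space and may be \<open>\<infinity>\<close>.
\<close>

definition DSC_R ::
  "'a measure \<Rightarrow> ('f::banach \<Rightarrow> 'a \<Rightarrow> real) \<Rightarrow> ('a set \<Rightarrow> real) measure \<Rightarrow> ennreal" where
  "DSC_R nu val P =
     (SUP f\<in>{f. f \<noteq> 0}. ennreal (sqrt (\<integral>nuh. \<bar>diff_integral nu nuh (val f)\<bar>\<^sup>2 \<partial>P) / norm f))"

text \<open>
  For an infinite denominator the quotient is \<open>0\<close>, because \<open>enn2real \<infinity> = 0\<close> and division by \<open>0\<close>
  yields \<open>0\<close>.
\<close>

definition CNF_R ::
  "'a measure \<Rightarrow> ('f::banach \<Rightarrow> 'a \<Rightarrow> real) \<Rightarrow> ('f \<Rightarrow> real) \<Rightarrow> ('a set \<Rightarrow> real) measure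
     \<Rightarrow> 'f \<Rightarrow> ('a set \<Rightarrow> real) \<Rightarrow> real" where
  "CNF_R nu val T P f nuh =
     (if ennreal (VAR_D nu val T f) * DSC_R nu val P \<noteq> 0
      then diff_integral nu nuh (val f) / enn2real (ennreal (VAR_D nu val T f) * DSC_R nu val P)
      else 0)"

end

theory Submission
  imports Defs
begin

text \<open>
  Write \<open>D f\<close> for the error \<open>diff_integral \<nu> \<nu>h (val f)\<close> of the random sampling measure \<open>\<nu>h\<close>, and
  let \<open>g = f - T f\<close>, so that the variation of \<open>f\<close> is \<open>norm g\<close>. The error is linear in \<open>f\<close> and
  vanishes on constants whenever \<open>\<nu>h\<close> has total mass one, so \<open>D f = D g\<close> almost surely
  (\<open>diff_integral_minus_const\<close>); if \<open>T\<close> is trivial, then \<open>g = f\<close> already.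
  The discrepancy is the smallest constant bounding the root mean square of the error by a multiple
  of the norm, hence, when it is finite,
  \<open>E (D f)\<^sup>2 = E (D g)\<^sup>2 \<le> (DSC * norm g)\<^sup>2\<close> (\<open>mean_square_error_le\<close>).

  Both claims are read off from this bound. The confounding is \<open>D f\<close> divided by
  \<open>DSC * norm g\<close> (\<open>CNF_R_eq_divide\<close>), so its mean square is at most one, and multiplying back
  returns \<open>D f\<close> unless \<open>DSC * norm g = 0\<close>; in that case the bound makes the mean square of \<open>D f\<close>
  zero, and the identity reads \<open>0 = 0\<close> almost surely. An infinite discrepancy makes the
  confounding vanish by convention, which leaves the moment bound trivially true.
\<close>

lemma val_const_fun:
  assumes "function_space X val" and "\<exists>g. \<forall>x\<in>space X. val g x = c"
  shows "\<forall>x\<in>space X. val (const_fun X val c) x = c"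
proof -
  have "\<exists>!g. \<forall>x\<in>space X. val g x = c"
    using assms unfolding function_space_def by metis
  from theI'[OF this] show ?thesis
    unfolding const_fun_def .
qed

lemma val_zero:
  assumes "function_space X val" and "x \<in> space X"
  shows "val 0 x = 0"
  using assms linear_0[of "\<lambda>f. val f x"] unfolding function_space_def by simp

lemma diff_integral_minus_const:
  assumes \<nu>: "prob_space \<nu>" and val: "function_space \<nu> val"
    and f: "integrable \<nu> (val f)"
    and h: "\<forall>x\<in>space \<nu>. val h x = c"
    and \<nu>h: "\<nu>h \<in> sampling_measures \<nu>" and mass: "c = 0 \<or> \<nu>h (space \<nu>) = 1"
  shows "diff_integral \<nu> \<nu>h (val (f - h)) = diff_integral \<nu> \<nu>h (val f)"
proof -
  interpret prob_space \<nu> by fact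
  obtain n w x where x: "\<forall>i<n. x i \<in> space \<nu>" and rep: "\<nu>h = dirac_sum \<nu> n w x"
    using \<nu>h unfolding sampling_measures_def by blast
  have meas: "val k \<in> borel_measurable \<nu>" for k
    using val unfolding function_space_def by blast
  have minus: "val (f - h) y = val f y - c" if "y \<in> space \<nu>" for y
    using that val h linear_diff[of "\<lambda>k. val k y" f h] unfolding function_space_def by simp
  have "(\<integral>y. val (f - h) y \<partial>\<nu>) = (\<integral>y. val f y - c \<partial>\<nu>)"
    by (rule Bochner_Integration.integral_cong) (simp_all add: minus)
  also have "\<dots> = (\<integral>y. val f y \<partial>\<nu>) - c"
    using f by (simp add: prob_space)
  finally have int: "(\<integral>y. val (f - h) y \<partial>\<nu>) = (\<integral>y. val f y \<partial>\<nu>) - c" .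
  have "\<nu>h (space \<nu>) = (\<Sum>i<n. w i)"
    unfolding rep dirac_sum_def using x by (simp add: measure_return)
  with mass have w: "c * (\<Sum>i<n. w i) = c" by auto
  have "(\<Sum>i<n. w i * val (f - h) (x i)) = (\<Sum>i<n. w i * val f (x i) - c * w i)"
    using x by (intro sum.cong) (simp_all add: minus algebra_simps)
  also have "\<dots> = (\<Sum>i<n. w i * val f (x i)) - c"
    by (simp add: sum_subtractf w flip: sum_distrib_left)
  finally have "sampling_integral \<nu> \<nu>h (val (f - h)) = sampling_integral \<nu> \<nu>h (val f) - c"
    unfolding rep sampling_integral_dirac_sum[OF meas x] .
  with int show ?thesis
    unfolding diff_integral_def by simp
qed

text \<open>
  The case \<open>norm g = 0\<close>, which the supremum in the discrepancy leaves out, holds because the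
  error of the zero function vanishes at every instance.
\<close>

lemma mean_square_error_le:
  assumes val: "function_space \<nu> val"
    and space_P: "space P = sampling_measures \<nu>"
    and finite: "DSC_R \<nu> val P < \<infinity>"
  shows "(\<integral>\<nu>h. (diff_integral \<nu> \<nu>h (val g))\<^sup>2 \<partial>P) \<le> (norm g * enn2real (DSC_R \<nu> val P))\<^sup>2"
proof (cases "g = 0")
  case True
  note zero = val_zero[OF val]
  have meas: "val 0 \<in> borel_measurable \<nu>"
    using val unfolding function_space_def by blast
  have "diff_integral \<nu> \<nu>h (val 0) = 0" if \<nu>h: "\<nu>h \<in> space P" for \<nu>h
  proof -
    obtain n w x where x: "\<forall>i<n. x i \<in> space \<nu>" and rep: "\<nu>h = dirac_sum \<nu> n w x"
      using \<nu>h unfolding space_P sampling_measures_def by blast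
    have "(\<integral>y. val 0 y \<partial>\<nu>) = (\<integral>y. 0 \<partial>\<nu>)"
      by (rule Bochner_Integration.integral_cong) (simp_all add: zero)
    then show ?thesis
      unfolding diff_integral_def rep sampling_integral_dirac_sum[OF meas x]
      using x by (simp add: zero)
  qed
  then have "(\<integral>\<nu>h. (diff_integral \<nu> \<nu>h (val 0))\<^sup>2 \<partial>P) = (\<integral>\<nu>h. 0 \<partial>P)"
    by (intro Bochner_Integration.integral_cong) simp_all
  with True show ?thesis by simp
next
  case False
  let ?E = "\<integral>\<nu>h. (diff_integral \<nu> \<nu>h (val g))\<^sup>2 \<partial>P"
  have "ennreal (sqrt ?E / norm g) \<le> DSC_R \<nu> val P"
    unfolding DSC_R_def using False by (intro SUP_upper2[of g]) simp_all
  then have "enn2real (ennreal (sqrt ?E / norm g)) \<le> enn2real (DSC_R \<nu> val P)"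
    using finite by (intro enn2real_mono) simp_all
  moreover have "0 \<le> ?E" by simp
  ultimately have "sqrt ?E \<le> norm g * enn2real (DSC_R \<nu> val P)"
    using False by (simp add: divide_le_eq mult.commute)
  then show ?thesis
    by (rule sqrt_le_D)
qed

text \<open>
  Extending the quotient by zero to a vanishing or an infinite denominator agrees with the
  conventions \<open>x / 0 = 0\<close> and \<open>enn2real \<infinity> = 0\<close>, so one formula covers all cases.
\<close>

lemma CNF_R_eq_divide:
  "CNF_R \<nu> val T P f \<nu>h =
     diff_integral \<nu> \<nu>h (val f) / (VAR_D \<nu> val T f * enn2real (DSC_R \<nu> val P))"
proof -
  have divide: "(if c \<noteq> 0 then r / enn2real c else 0) = r / enn2real c" for c r
    by simp
  have "VAR_D \<nu> val T f * enn2real (DSC_R \<nu> val P) =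
      enn2real (ennreal (VAR_D \<nu> val T f) * DSC_R \<nu> val P)"
    by (simp add: enn2real_mult VAR_D_def)
  then show ?thesis
    unfolding CNF_R_def divide by (simp only:)
qed

theorem theorem2:
  fixes \<nu> :: "'a measure"
    and val :: "'f::banach \<Rightarrow> 'a \<Rightarrow> real"
    and T :: "'f \<Rightarrow> real"
    and P :: "('a set \<Rightarrow> real) measure"
  assumes "prob_space \<nu>"
    and "function_space \<nu> val"
    and "\<And>f. integrable \<nu> (val f)"
    and "bounded_linear T"
    and "range T \<noteq> {0} \<Longrightarrow> \<forall>c. \<exists>g. \<forall>x\<in>space \<nu>. val g x = c"
    and "prob_space P"
    and "space P = sampling_measures \<nu>"
    and "\<And>f. (\<lambda>\<nu>h. sampling_integral \<nu> \<nu>h (val f)) \<in> borel_measurable P"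
    and "\<And>f. integrable P (\<lambda>\<nu>h. \<bar>sampling_integral \<nu> \<nu>h (val f)\<bar>\<^sup>2)"
    and "range T = {0} \<or> (AE \<nu>h in P. \<nu>h (space \<nu>) = measure \<nu> (space \<nu>))"
  shows "(\<forall>f. DSC_R \<nu> val P < \<infinity> \<longrightarrow>
            (AE \<nu>h in P. (\<integral>x. val f x \<partial>\<nu>) - sampling_integral \<nu> \<nu>h (val f) =
               CNF_R \<nu> val T P f \<nu>h * enn2real (DSC_R \<nu> val P) * VAR_D \<nu> val T f)) \<and>
         (\<forall>f. integrable P (\<lambda>\<nu>h. \<bar>CNF_R \<nu> val T P f \<nu>h\<bar>\<^sup>2) \<and>
            (\<integral>\<nu>h. \<bar>CNF_R \<nu> val T P f \<nu>h\<bar>\<^sup>2 \<partial>P) \<le> 1)"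
proof -
  interpret \<nu>: prob_space \<nu> by (rule assms(1))
  interpret P: prob_space P by (rule assms(6))
  let ?D = "\<lambda>f \<nu>h. diff_integral \<nu> \<nu>h (val f)"
  let ?d = "enn2real (DSC_R \<nu> val P)"
  have sampling_int: "integrable P (\<lambda>\<nu>h. sampling_integral \<nu> \<nu>h (val f))" for f
    using assms(9)[of f] by (simp add: P.square_integrable_imp_integrable[OF assms(8)])
  have meas [measurable]: "?D f \<in> borel_measurable P" for f
    using assms(8)[of f] unfolding diff_integral_def by simp
  have square_int: "integrable P (\<lambda>\<nu>h. (?D f \<nu>h)\<^sup>2)" for f
    using sampling_int[of f] assms(9)[of f] unfolding diff_integral_def power2_diff by simp
  have const: "\<forall>x\<in>space \<nu>. val (const_fun \<nu> val (T f)) x = T f" for f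
  proof (rule val_const_fun[OF assms(2)], cases "range T = {0}")
    case True
    \<comment> \<open>The only constant that occurs is \<open>T f = 0\<close>, represented by the zero of the space.\<close>
    then have "T f = 0" by (metis rangeI singletonD)
    then show "\<exists>g. \<forall>x\<in>space \<nu>. val g x = T f"
      using val_zero[OF assms(2)] by (intro exI[of _ 0]) simp
  next
    case False
    then show "\<exists>g. \<forall>x\<in>space \<nu>. val g x = T f"
      using assms(5) by blast
  qed
  have mass: "AE \<nu>h in P. T f = 0 \<or> \<nu>h (space \<nu>) = 1" for f
  proof (cases "range T = {0}")
    case True
    then have "T f = 0" by (metis rangeI singletonD)
    then show ?thesis by simp
  next
    case False
    with assms(10) show ?thesis by (simp add: \<nu>.prob_space)
  qed
  have centred: "AE \<nu>h in P. ?D (f - const_fun \<nu> val (T f)) \<nu>h = ?D f \<nu>h" for f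
    using mass[of f] AE_space[of P]
    by eventually_elim
      (rule diff_integral_minus_const[OF assms(1,2,3) const], simp_all add: assms(7))
  have mean_square: "(\<integral>\<nu>h. (?D f \<nu>h)\<^sup>2 \<partial>P) \<le> (VAR_D \<nu> val T f * ?d)\<^sup>2"
    if "DSC_R \<nu> val P < \<infinity>" for f
  proof -
    have "(\<integral>\<nu>h. (?D f \<nu>h)\<^sup>2 \<partial>P) = (\<integral>\<nu>h. (?D (f - const_fun \<nu> val (T f)) \<nu>h)\<^sup>2 \<partial>P)"
      using centred[of f] by (intro integral_cong_AE) auto
    then show ?thesis
      unfolding VAR_D_def using mean_square_error_le[OF assms(2,7) that] by simp
  qed
  have identity: "AE \<nu>h in P. (\<integral>x. val f x \<partial>\<nu>) - sampling_integral \<nu> \<nu>h (val f) =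
      CNF_R \<nu> val T P f \<nu>h * ?d * VAR_D \<nu> val T f" if "DSC_R \<nu> val P < \<infinity>" for f
  proof (cases "VAR_D \<nu> val T f * ?d = 0")
    case True
    have "(\<integral>\<nu>h. (?D f \<nu>h)\<^sup>2 \<partial>P) \<le> 0"
      using mean_square[OF that, of f] unfolding True by simp
    moreover have "(\<integral>\<nu>h. (?D f \<nu>h)\<^sup>2 \<partial>P) \<ge> 0" by simp
    ultimately have "(\<integral>\<nu>h. (?D f \<nu>h)\<^sup>2 \<partial>P) = 0" by (rule antisym)
    then have "AE \<nu>h in P. ?D f \<nu>h = 0"
      using integral_nonneg_eq_0_iff_AE[OF square_int] by simp
    then show ?thesis
      by eventually_elim (auto simp: CNF_R_eq_divide diff_integral_def)
  next
    case False
    then show ?thesis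
      by (simp add: CNF_R_eq_divide diff_integral_def)
  qed
  have cnf: "integrable P (\<lambda>\<nu>h. \<bar>CNF_R \<nu> val T P f \<nu>h\<bar>\<^sup>2)"
    "(\<integral>\<nu>h. \<bar>CNF_R \<nu> val T P f \<nu>h\<bar>\<^sup>2 \<partial>P) \<le> 1" for f
  proof -
    show "integrable P (\<lambda>\<nu>h. \<bar>CNF_R \<nu> val T P f \<nu>h\<bar>\<^sup>2)"
      using square_int[of f] by (simp add: CNF_R_eq_divide power_divide)
    show "(\<integral>\<nu>h. \<bar>CNF_R \<nu> val T P f \<nu>h\<bar>\<^sup>2 \<partial>P) \<le> 1"
    proof (cases "VAR_D \<nu> val T f * ?d = 0")
      case True
      then show ?thesis by (auto simp: CNF_R_eq_divide)
    next
      case False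
      \<comment> \<open>A nonzero real value of the discrepancy also excludes that it is infinite.\<close>
      then have "DSC_R \<nu> val P < \<infinity>"
        by (metis enn2real_top infinity_ennreal_def less_top mult_zero_right)
      with False mean_square[of f] show ?thesis
        by (simp add: CNF_R_eq_divide power_divide)
    qed
  qed
  from identity cnf show ?thesis by blast
qed

end
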